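(* For every integer $a\geq 1$, $f_2(a)\leq 2a^3+2$; that is, every $(2a^3+2)$-connected digraph $D$ with $\alpha_2(D)\leq a$ is Hamiltonian (i.e. has a directed Hamilton cycle).
   Context: All digraphs are finite, without loops and without multiple arcs (two opposite arcs $u\to v$ and $v\to u$ are allowed). A digraph is strongly connected if it contains a directed path from each vertex to every other one. A digraph $D$ is $K$-connected if $|V(D)|\geq K+1$ and $D-X$ is strongly connected for every $X\subseteq V(D)$ with $|X|<K$. A Hamilton cycle of a digraph is a directed cycle through all of its vertices; a digraph is Hamiltonian if it has a Hamilton cycle. Two vertices $u,v$ form a directed $2$-cycle of $D$ if $D$ contains both arcs $u\to v$ and $v\to u$. Let $G(D)$ be the undirected graph on $V(D)$ in which $uv$ is an edge precisely when $u$ and $v$ form a directed $2$-cycle of $D$, and let $\alpha_2(D)=\alpha(G(D))$ be its independence number; thus $\alpha_2(D)$ is the largest size of a vertex set no two of whose vertices lie in a common directed $2$-cycle of $D$. For an integer $a\geq 1$, $f_2(a)$ denotes the least integer $K$ such that every $K$-connected digraph $D$ with $\alpha_2(D)\leq a$ is Hamiltonian. *)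

theory Defs
  imports "Graph_Theory.Graph_Theory"
begin

text \<open>
  Digraphs are those of the locale \<^locale>\<open>digraph\<close>: finite, loop-free, without parallel arcs.
  The condition on the number of vertices ensures that \<open>D - X\<close> is never empty, so it is
  irrelevant that \<^const>\<open>strongly_connected\<close> excludes the null digraph.
\<close>

definition k_connected :: "nat \<Rightarrow> ('a, 'b) pre_digraph \<Rightarrow> bool" where
  "k_connected K D \<longleftrightarrow> card (verts D) \<ge> K + 1 \<and>
     (\<forall>X. X \<subseteq> verts D \<and> card X < K \<longrightarrow> strongly_connected (D \<restriction> (verts D - X)))"

text \<open>
  \<^const>\<open>pre_digraph.cycle\<close> admits cycles of length 2 (and of length 1, but there are no loops
  here); the tails of its arcs are exactly its vertices.
\<close>

definition hamilton_cycle :: "('a, 'b) pre_digraph \<Rightarrow> 'b awalk \<Rightarrow> bool" where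
  "hamilton_cycle D p \<longleftrightarrow> pre_digraph.cycle D p \<and> tail D ` set p = verts D"

definition hamiltonian :: "('a, 'b) pre_digraph \<Rightarrow> bool" where
  "hamiltonian D \<longleftrightarrow> (\<exists>p. hamilton_cycle D p)"

text \<open>Undirected graphs are represented as symmetric digraphs, see \<^locale>\<open>graph\<close>.\<close>

definition two_cycle_graph :: "('a, 'b) pre_digraph \<Rightarrow> 'a pair_pre_digraph" where
  "two_cycle_graph D =
     \<lparr>pverts = verts D, parcs = {(u, v). u \<rightarrow>\<^bsub>D\<^esub> v \<and> v \<rightarrow>\<^bsub>D\<^esub> u}\<rparr>"

lemma graph_two_cycle_graph:
  assumes "digraph D"
  shows "graph (with_proj (two_cycle_graph D))"
proof -
  interpret digraph D by fact
  have sub: "{(u, v). u \<rightarrow>\<^bsub>D\<^esub> v \<and> v \<rightarrow>\<^bsub>D\<^esub> u} \<subseteq> arcs_ends D" by auto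
  have fin: "finite {(u, v). u \<rightarrow>\<^bsub>D\<^esub> v \<and> v \<rightarrow>\<^bsub>D\<^esub> u}"
    by (rule finite_subset[OF sub]) (simp add: arcs_ends_def)
  show ?thesis
    by unfold_locales
      (auto simp: two_cycle_graph_def fin arc_to_ends_def symmetric_def sym_def
        dest: adj_in_verts adj_not_same)
qed

definition independent_set :: "('a, 'b) pre_digraph \<Rightarrow> 'a set \<Rightarrow> bool" where
  "independent_set G S \<longleftrightarrow> S \<subseteq> verts G \<and> (\<forall>u\<in>S. \<forall>v\<in>S. \<not> u \<rightarrow>\<^bsub>G\<^esub> v)"

definition independence_number :: "('a, 'b) pre_digraph \<Rightarrow> nat" where
  "independence_number G = Max (card ` {S. independent_set G S})"

definition alpha2 :: "('a, 'b) pre_digraph \<Rightarrow> nat" where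
  "alpha2 D = independence_number (with_proj (two_cycle_graph D))"

text \<open>
  Since HOL cannot quantify over types inside a formula, \<open>f2\<close> ranges over the digraphs whose
  vertices and arcs are natural numbers; every finite digraph is isomorphic to one of these.
  Taking \<open>K\<close> to be natural rather than an integer makes no difference for \<open>a \<ge> 1\<close>: the digraph
  with a single vertex is 0-connected and not Hamiltonian.
\<close>

definition f2 :: "nat \<Rightarrow> nat" where
  "f2 a = (LEAST K. \<forall>D :: (nat, nat) pre_digraph.
     digraph D \<and> k_connected K D \<and> alpha2 D \<le> a \<longrightarrow> hamiltonian D)"

end

theory Submission
  imports Defs
begin

text \<open>
  Call two vertices adjacent if they lie on a common 2-cycle, and put \<open>\<mu> = 2a\<^sup>2 - a\<close>. Splitting
  repeatedly along separators of size at most \<open>\<mu>\<close> decomposes the vertex set into at most \<open>a\<close>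
  pairwise nonadjacent highly connected blocks and a set \<open>X\<close> of about \<open>2a\<^sup>3\<close> exceptional vertices,
  which are regarded as singleton blocks. The graph of blocks still has independence number at most
  \<open>a\<close>, so the blocks are covered by at most \<open>a\<close> paths. The ends of these paths are linked cyclically by
  geodesics of the digraph that avoid \<open>X\<close> and the entry and exit vertices of the blocks; a geodesic
  has at most \<open>2a\<close> vertices, since every other one of them can be put into an independent set. The
  links delete at most \<open>a(2a - 2) = \<mu> - a\<close> vertices in all, hence what is left of each block is
  sufficiently connected for a Chvatal--Erdos argument to join its entry and exit by a Hamilton path.
\<close>

section \<open>Walks and geodesics\<close>

lemma walk_of_rtranclp:
  assumes "R\<^sup>*\<^sup>* u v"
  shows "\<exists>xs. xs \<noteq> [] \<and> hd xs = u \<and> last xs = v \<and> successively R xs"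
  using assms
proof induction
  case base
  show ?case by (intro exI[of _ "[u]"]) auto
next
  case (step y z)
  then obtain xs where "xs \<noteq> []" "hd xs = u" "last xs = y" "successively R xs" by blast
  with step show ?case
    by (intro exI[of _ "xs @ [z]"]) (auto simp: successively_append_iff)
qed

text \<open>A walk of minimal length has all these properties: a repeated vertex, or a step from
  position \<open>i\<close> to one beyond \<open>i + 1\<close>, would give a shortcut. Steps
  backwards along the walk are not excluded.\<close>

lemma geodesic_exists:
  assumes "R\<^sup>*\<^sup>* u v"
  obtains xs where "xs \<noteq> []" "hd xs = u" "last xs = v" "successively R xs" "distinct xs"
    "\<forall>i j. i + 1 < j \<longrightarrow> j < length xs \<longrightarrow> \<not> R (xs ! i) (xs ! j)"
proof -
  define good where
    "good xs \<longleftrightarrow> xs \<noteq> [] \<and> hd xs = u \<and> last xs = v \<and> successively R xs" for xs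
  obtain ys where "good ys" using walk_of_rtranclp[OF assms] unfolding good_def by blast
  then obtain xs where xs: "good xs" and min: "\<And>zs. good zs \<Longrightarrow> length xs \<le> length zs"
    using ex_has_least_nat[of good ys length] by blast
  have "distinct xs"
  proof (rule ccontr)
    assume "\<not> distinct xs"
    then obtain as bs cs y where d: "xs = as @ [y] @ bs @ [y] @ cs"
      using not_distinct_decomp by blast
    have "good (as @ [y] @ cs)"
      using xs unfolding good_def d by (auto simp: successively_append_iff successively_Cons hd_append)
    from min[OF this] show False by (simp add: d)
  qed
  moreover have "\<not> R (xs ! i) (xs ! j)" if ij: "i + 1 < j" "j < length xs" for i j
  proof
    assume R: "R (xs ! i) (xs ! j)"
    have eq: "xs = take (Suc i) xs @ drop (Suc i) xs" "xs = take j xs @ drop j xs" by auto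
    have "hd (take (Suc i) xs) = u" using xs ij by (cases xs) (auto simp: good_def)
    moreover have "last (drop j xs) = v" using xs ij by (auto simp: good_def)
    moreover have "successively R (take (Suc i) xs)" "successively R (drop j xs)"
      using xs eq unfolding good_def by (metis successively_append_iff)+
    moreover have "last (take (Suc i) xs) = xs ! i" "hd (drop j xs) = xs ! j"
      using ij by (auto simp: take_Suc_conv_app_nth hd_drop_conv_nth)
    ultimately have "good (take (Suc i) xs @ drop j xs)"
      using R ij xs unfolding good_def by (auto simp: successively_append_iff)
    from min[OF this] show False using ij by simp
  qed
  ultimately show ?thesis using that xs unfolding good_def by blast
qed

lemma successively_imp_rtranclp:
  assumes "successively R xs" "x \<in> set xs"
  shows "R\<^sup>*\<^sup>* (hd xs) x"
  using assms
proof (induction xs rule: induct_list012)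
  case (3 y z zs)
  then show ?case by (auto intro: converse_rtranclp_into_rtranclp)
qed auto

section \<open>Robust vertex sets\<close>

definition nbhd :: "('a \<Rightarrow> 'a \<Rightarrow> bool) \<Rightarrow> 'a set \<Rightarrow> 'a set \<Rightarrow> 'a set" where
  "nbhd M W H = {w \<in> W - H. \<exists>h\<in>H. M h w}"

text \<open>For \<open>card W > k + 1\<close> this says that the subgraph induced by \<open>W\<close> is \<open>(k + 1)\<close>-connected.\<close>

definition robust :: "('a \<Rightarrow> 'a \<Rightarrow> bool) \<Rightarrow> nat \<Rightarrow> 'a set \<Rightarrow> bool" where
  "robust M k W \<longleftrightarrow> (\<forall>H\<subseteq>W. H \<noteq> {} \<and> card (nbhd M W H) \<le> k \<longrightarrow> H \<union> nbhd M W H = W)"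

lemma robustD:
  assumes "robust M k W" "H \<subseteq> W" "H \<noteq> {}" "card (nbhd M W H) \<le> k"
  shows "H \<union> nbhd M W H = W"
  using assms unfolding robust_def by blast

definition indep :: "('a \<Rightarrow> 'a \<Rightarrow> bool) \<Rightarrow> 'a set \<Rightarrow> bool" where
  "indep M S \<longleftrightarrow> (\<forall>u\<in>S. \<forall>v\<in>S. \<not> M u v)"

definition alpha_le :: "('a \<Rightarrow> 'a \<Rightarrow> bool) \<Rightarrow> 'a set \<Rightarrow> nat \<Rightarrow> bool" where
  "alpha_le M W b \<longleftrightarrow> (\<forall>S\<subseteq>W. indep M S \<longrightarrow> card S \<le> b)"

lemma alpha_le_mono: "alpha_le M W b \<Longrightarrow> W' \<subseteq> W \<Longrightarrow> b \<le> b' \<Longrightarrow> alpha_le M W' b'"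
  unfolding alpha_le_def by (meson le_trans subset_trans)

text \<open>Putting \<open>L\<close> back gives a subset of \<open>W - L\<close> at most
  \<open>l\<close> further neighbours, so the hypothesis on \<open>W\<close> still applies to it. In
  this way blocks survive the deletion of the vertices used by links.\<close>

lemma robust_Diff:
  assumes "finite W" "robust M (k + l) W" "L \<subseteq> W" "card L \<le> l"
  shows "robust M k (W - L)"
  unfolding robust_def
proof (intro allI impI, elim conjE)
  fix H assume H: "H \<subseteq> W - L" "H \<noteq> {}" "card (nbhd M (W - L) H) \<le> k"
  have sub: "nbhd M W H \<subseteq> nbhd M (W - L) H \<union> L" by (auto simp: nbhd_def)
  have "finite (nbhd M (W - L) H \<union> L)"
    using assms(1,3) by (auto simp: nbhd_def intro: finite_subset)
  then have "card (nbhd M W H) \<le> card (nbhd M (W - L) H) + card L"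
    using sub card_mono card_Un_le le_trans by metis
  then have "card (nbhd M W H) \<le> k + l" using assms(4) H(3) by linarith
  moreover have "H \<subseteq> W" using H(1) by blast
  ultimately have "H \<union> nbhd M W H = W"
    using robustD[OF assms(2)] H(2) by blast
  then show "H \<union> nbhd M (W - L) H = W - L" using H(1) unfolding nbhd_def by blast
qed

text \<open>\<open>H\<close> is the component of \<open>u\<close> in the graph induced by
  \<open>W\<close>, and geodesics supply the paths inside it. These paths give a first path from
  \<open>s\<close> to \<open>t\<close> and later the detours off a longest path.\<close>

lemma component_exists:
  assumes "symp M" "u \<in> W"
  obtains H where "H \<subseteq> W" "u \<in> H" "nbhd M W H = {}"
    "\<forall>h\<in>H. \<forall>h'\<in>H.
       \<exists>Q. Q \<noteq> [] \<and> hd Q = h \<and> last Q = h' \<and> distinct Q \<and> set Q \<subseteq> H \<and> successively M Q"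
proof -
  define R where "R x y \<longleftrightarrow> M x y \<and> x \<in> W \<and> y \<in> W" for x y
  define H where "H = {w. R\<^sup>*\<^sup>* u w}"
  have "symp R" using assms(1) by (auto simp: R_def symp_def)
  then have sym: "symp R\<^sup>*\<^sup>*" by (rule symp_rtranclp)
  have "w \<in> W" if "R\<^sup>*\<^sup>* u w" for w using that assms(2) by induction (auto simp: R_def)
  then have HW: "H \<subseteq> W" by (auto simp: H_def)
  moreover have "u \<in> H" by (simp add: H_def)
  moreover have "nbhd M W H = {}"
  proof -
    have "w \<in> H" if "h \<in> H" "M h w" "w \<in> W" for h w
    proof -
      have "R h w" using that HW by (auto simp: R_def)
      then show ?thesis using that(1) unfolding H_def by (auto intro: rtranclp.rtrancl_into_rtrancl)
    qed
    then show ?thesis by (auto simp: nbhd_def)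
  qed
  moreover have "\<exists>Q. Q \<noteq> [] \<and> hd Q = h \<and> last Q = h' \<and> distinct Q \<and> set Q \<subseteq> H \<and> successively M Q"
    if "h \<in> H" "h' \<in> H" for h h'
  proof -
    have "R\<^sup>*\<^sup>* h h'" using that sym unfolding H_def by (metis mem_Collect_eq rtranclp_trans sympD)
    then obtain Q where Q: "Q \<noteq> []" "hd Q = h" "last Q = h'" "successively R Q" "distinct Q"
      by (rule geodesic_exists)
    have "set Q \<subseteq> H"
      using successively_imp_rtranclp[OF Q(4)] Q(2) that(1) unfolding H_def
      by (metis mem_Collect_eq rtranclp_trans subsetI)
    moreover have "successively M Q" using Q(4) by (rule successively_mono) (auto simp: R_def)
    ultimately show ?thesis using Q by blast
  qed
  ultimately show ?thesis by (intro that) blast+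
qed

section \<open>Hamilton paths with prescribed ends in robust sets\<close>

text \<open>
  The Chvatal--Erdos argument: for a component \<open>H\<close> outside a longest path, the successors of the
  neighbours of \<open>H\<close> on the path, together with a vertex of \<open>H\<close>, are independent.
\<close>

lemma robust_hamilton_connected:
  assumes fin: "finite B" and sym: "symp M" and irr: "\<And>x. \<not> M x x"
    and alpha: "alpha_le M B a" and rob: "robust M a B"
    and st: "s \<in> B" "t \<in> B" "s \<noteq> t"
  shows "\<exists>P. distinct P \<and> set P = B \<and> successively M P \<and> P \<noteq> [] \<and> hd P = s \<and> last P = t"
proof -
  have M_sym: "M x y \<Longrightarrow> M y x" for x y using sym by (rule sympD)
  define good where "good P \<longleftrightarrow> distinct P \<and> set P \<subseteq> B \<and> successively M P \<and> P \<noteq> [] \<and> hd P = s \<and> last P = t" for P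
  \<comment> \<open>Some path from \<open>s\<close> to \<open>t\<close> exists: the component of
    \<open>s\<close> has no neighbours, so robustness makes it all of \<open>B\<close>.\<close>
  obtain P0 where P0: "good P0"
  proof -
    obtain H where H: "H \<subseteq> B" "s \<in> H" "nbhd M B H = {}"
      "\<forall>h\<in>H. \<forall>h'\<in>H.
       \<exists>Q. Q \<noteq> [] \<and> hd Q = h \<and> last Q = h' \<and> distinct Q \<and> set Q \<subseteq> H \<and> successively M Q"
      by (rule component_exists[OF sym st(1)])
    have "H \<noteq> {}" "card (nbhd M B H) \<le> a" using H(2,3) by auto
    then have "H = B" using robustD[OF rob H(1)] H(3) by simp
    then have "s \<in> H" "t \<in> H" using st by auto
    from H(4)[rule_format, OF this] that H(1) show ?thesis unfolding good_def by blast
  qed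
  have "length P \<le> card B" if "good P" for P
    using that fin unfolding good_def by (metis card_mono distinct_card)
  then obtain P where P: "good P" and max: "\<And>Q. good Q \<Longrightarrow> length Q \<le> length P"
    using ex_has_greatest_nat[of good P0 length "Suc (card B)"] P0 le_imp_less_Suc by blast
  have "set P = B"
  proof (rule ccontr)
    assume "set P \<noteq> B"
    then obtain u where u: "u \<in> B - set P" using P unfolding good_def by blast
    obtain H where H: "H \<subseteq> B - set P" "u \<in> H" "nbhd M (B - set P) H = {}"
      and conn: "\<forall>h\<in>H. \<forall>h'\<in>H.
       \<exists>Q. Q \<noteq> [] \<and> hd Q = h \<and> last Q = h' \<and> distinct Q \<and> set Q \<subseteq> H \<and> successively M Q"
      by (rule component_exists[OF sym u])
    define N where "N = nbhd M B H"
    have NP: "N \<subseteq> set P" using H(3) unfolding N_def nbhd_def by blast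
    \<comment> \<open>All neighbours of the component \<open>H\<close> lie on \<open>P\<close>, and
      any two of them can be joined through \<open>H\<close>, off the path.\<close>
    have detour: "\<exists>Q. Q \<noteq> [] \<and> M x (hd Q) \<and> M (last Q) y \<and> distinct Q \<and> set Q \<inter> set P = {} \<and> set Q \<subseteq> B \<and> successively M Q"
      if xy: "x \<in> N" "y \<in> N" for x y
    proof -
      obtain h h' where h: "h \<in> H" "M x h" "h' \<in> H" "M h' y"
        using xy M_sym unfolding N_def nbhd_def by blast
      then show ?thesis using conn[rule_format, OF h(1,3)] h(2,4) H(1) by blast
    qed
    have no_consecutive: False if d: "P = ps @ x # y # rs" and xy: "x \<in> N" "y \<in> N" for ps x y rs
    proof -
      obtain Q where Q: "Q \<noteq> []" "M x (hd Q)" "M (last Q) y" "distinct Q" "set Q \<inter> set P = {}"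
          "set Q \<subseteq> B" "successively M Q"
        using detour[OF xy] by blast
      have "good (ps @ [x] @ Q @ y # rs)"
        using P Q unfolding good_def d
        by (auto simp: successively_append_iff successively_Cons hd_append)
      from max[OF this] show False using Q(1) by (simp add: d)
    qed
    \<comment> \<open>The longer path goes from \<open>x\<close> through \<open>H\<close> to
      \<open>last ms\<close>, runs back along \<open>ms\<close> to \<open>hd ms\<close>, and jumps
      to \<open>y\<close>; it keeps every vertex of \<open>P\<close>.\<close>
    have no_crossing: False
      if d: "P = ps @ x # ms @ y # rs" and ms: "ms \<noteq> []" "x \<in> N" "last ms \<in> N" "M (hd ms) y"
      for ps x ms y rs
    proof -
      obtain Q where Q: "Q \<noteq> []" "M x (hd Q)" "M (last Q) (last ms)" "distinct Q" "set Q \<inter> set P = {}"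
          "set Q \<subseteq> B" "successively M Q"
        using detour[OF ms(2,3)] by blast
      have "successively M (rev ms)"
        using P M_sym unfolding good_def d
        by (auto simp: successively_append_iff successively_Cons intro: successively_mono)
      then have "good (ps @ [x] @ Q @ rev ms @ y # rs)"
        using P Q ms(1,4) unfolding good_def d
        by (auto simp: successively_append_iff successively_Cons hd_append hd_rev last_rev)
      from max[OF this] show False using Q(1) by (simp add: d)
    qed
    \<comment> \<open>Positions of the vertices of \<open>N\<close> that have a successor on
      \<open>P\<close>. Only the end \<open>t\<close> has none, so \<open>card N\<close> is at most
      \<open>card I + 1\<close>.\<close>
    define I where "I = {i. Suc i < length P \<and> P ! i \<in> N}"
    define T where "T = (\<lambda>i. P ! Suc i) ` I"
    have dP: "distinct P" using P by (simp add: good_def)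
    have succ_notin: "P ! Suc i \<notin> N" if "i \<in> I" for i
    proof
      assume "P ! Suc i \<in> N"
      moreover have "P = take i P @ P ! i # P ! Suc i # drop (Suc (Suc i)) P"
        using that unfolding I_def
        by (metis (no_types, lifting) Cons_nth_drop_Suc Suc_lessD id_take_nth_drop mem_Collect_eq)
      ultimately show False using no_consecutive that unfolding I_def by blast
    qed
    have no_chord: "\<not> M (P ! Suc i) (P ! Suc j)" if ij: "i \<in> I" "j \<in> I" "i < j" for i j
    proof
      assume M: "M (P ! Suc i) (P ! Suc j)"
      define ms where "ms = take (j - i) (drop (Suc i) P)"
      have len: "Suc j < length P" using ij by (simp add: I_def)
      have "drop (Suc i) P = ms @ drop (Suc j) P"
        unfolding ms_def using ij(3)
        by (metis Suc_diff_Suc append_take_drop_id diff_Suc_Suc drop_drop le_add_diff_inverse2 less_imp_le_nat add_Suc_right)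
      then have d: "P = take i P @ P ! i # ms @ P ! Suc j # drop (Suc (Suc j)) P"
        using len ij(3) by (metis Cons_nth_drop_Suc Suc_lessD id_take_nth_drop less_trans)
      have lms: "length ms = j - i" using len ij(3) by (simp add: ms_def)
      then have "ms \<noteq> []" using ij(3) by auto
      moreover have "last ms = P ! j"
        using lms len ij(3) \<open>ms \<noteq> []\<close> by (simp add: last_conv_nth ms_def)
      moreover have "hd ms = P ! Suc i"
        using len ij(3) by (simp add: ms_def hd_drop_conv_nth)
      ultimately show False using no_crossing[OF d] M ij(1,2) by (simp add: I_def)
    qed
    have uT: "u \<notin> T" using u by (auto simp: T_def I_def)
    \<comment> \<open>Adjacent successors would give a crossing. A successor lies neither in
      \<open>H\<close> nor in \<open>N\<close>, so it is not adjacent to \<open>u\<close>, which is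
      in \<open>H\<close>.\<close>
    have "indep M (insert u T)"
    proof -
      have "\<not> M (P ! Suc i) (P ! Suc j)" if "i \<in> I" "j \<in> I" for i j
        using no_chord[of i j] no_chord[of j i] that M_sym irr by (metis nat_neq_iff)
      moreover have "\<not> M u (P ! Suc i)" if "i \<in> I" for i
      proof -
        have "P ! Suc i \<in> set P" using that by (simp add: I_def)
        then show ?thesis
          using succ_notin[OF that] H(1,2) P unfolding N_def nbhd_def good_def by blast
      qed
      ultimately show ?thesis using M_sym irr unfolding indep_def T_def by blast
    qed
    moreover have "insert u T \<subseteq> B" using u P by (auto simp: T_def I_def good_def)
    ultimately have "card (insert u T) \<le> a" using alpha unfolding alpha_le_def by blast
    moreover have finI: "finite I" by (rule finite_subset[of _ "{..<length P}"]) (auto simp: I_def)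
    moreover have "card T = card I"
      unfolding T_def using dP by (intro card_image) (auto simp: inj_on_def I_def nth_eq_iff_index_eq)
    ultimately have cI: "Suc (card I) \<le> a" using uT by (simp add: T_def)
    have "N \<subseteq> insert t ((\<lambda>i. P ! i) ` I)"
    proof
      fix x assume x: "x \<in> N"
      then obtain i where i: "i < length P" "x = P ! i" using NP by (metis in_set_conv_nth subsetD)
      show "x \<in> insert t ((\<lambda>i. P ! i) ` I)"
      proof (cases "Suc i < length P")
        case False
        then have "x = t" using i P unfolding good_def
          by (metis Suc_lessI diff_Suc_1 last_conv_nth)
        then show ?thesis by simp
      qed (use x i in \<open>auto simp: I_def\<close>)
    qed
    then have "card N \<le> card (insert t ((\<lambda>i. P ! i) ` I))" by (intro card_mono) (auto simp: finI)
    also have "\<dots> \<le> Suc (card I)"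
      using card_image_le[OF finI, of "\<lambda>i. P ! i"] by (auto simp: card_insert_if finI)
    finally have "card (nbhd M B H) \<le> a" using cI by (simp add: N_def)
    moreover have "H \<subseteq> B" "H \<noteq> {}" using H(1,2) by auto
    \<comment> \<open>\<open>N\<close> is too small to separate \<open>H\<close> from anything, so
      all of \<open>P\<close> lies in \<open>N\<close>. But the first two vertices of
      \<open>P\<close>, which exist since \<open>s\<close> and \<open>t\<close> differ, cannot both
      be in \<open>N\<close>.\<close>
    ultimately have "H \<union> N = B" using robustD[OF rob] unfolding N_def by blast
    then have PN: "set P \<subseteq> N" using P H(1) unfolding good_def by blast
    obtain y ys where "P = s # y # ys"
      using P st(3) unfolding good_def by (metis last_ConsL list.collapse)
    then show False using no_consecutive[of "[]" s y ys] PN by auto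
  qed
  with P show ?thesis unfolding good_def by blast
qed

section \<open>Splitting along small separators\<close>

text \<open>Parts with fewer than \<open>m\<close> vertices are thrown into the exceptional set \<open>X\<close>.\<close>

lemma robust_decomposition:
  fixes M :: "'a \<Rightarrow> 'a \<Rightarrow> bool"
  assumes sym: "symp M" and irr: "\<And>x. \<not> M x x" and m: "2 \<le> m"
    and "finite W" "alpha_le M W b"
  shows "\<exists>X \<A>. X \<subseteq> W \<and> \<Union>\<A> = W - X \<and> pairwise disjnt \<A> \<and>
      (\<forall>A\<in>\<A>. robust M k A \<and> m \<le> card A) \<and>
      (\<forall>A\<in>\<A>. \<forall>B\<in>\<A>. A \<noteq> B \<longrightarrow> (\<forall>x\<in>A. \<forall>y\<in>B. \<not> M x y)) \<and>
      card X + 2 * card \<A> \<le> (b - 1) * k + b * m"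
  using assms(4,5)
proof (induction b arbitrary: W rule: less_induct)
  case (less b)
  note fin = \<open>finite W\<close> and alpha = \<open>alpha_le M W b\<close>
  have sing: "indep M {x}" for x using irr by (simp add: indep_def)
  consider "W = {}" | "W \<noteq> {}" "robust M k W" | "\<not> robust M k W" by blast
  then show ?case
  proof cases
    case 1
    then show ?thesis by (intro exI[of _ "{}"]) auto
  next
    case 2
    then have "1 \<le> b" using alpha sing unfolding alpha_le_def
      by (metis card_1_singleton_iff empty_subsetI ex_in_conv insert_subset One_nat_def)
    \<comment> \<open>A robust \<open>W\<close> either becomes a single block, at cost 2, or goes
      entirely into \<open>X\<close>, at cost less than \<open>m\<close>; \<open>b * m\<close>
      covers both.\<close>
    then have bm: "m \<le> b * m" by simp
    show ?thesis
    proof (cases "m \<le> card W")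
      case True
      moreover have "2 \<le> (b - 1) * k + b * m" using bm m by linarith
      ultimately show ?thesis using 2
        by (intro exI[of _ "{} :: 'a set"] exI[of _ "{W}"]) auto
    next
      case False
      then have "card W \<le> (b - 1) * k + b * m" using bm by linarith
      then show ?thesis
        by (intro exI[of _ W] exI[of _ "{} :: 'a set set"]) auto
    qed
  next
    case 3
    \<comment> \<open>A witness against robustness is one side of a separation: its small
      neighbourhood \<open>Y\<close> cuts it off from a nonempty rest \<open>W2\<close>.\<close>
    then obtain W1 where W1: "W1 \<subseteq> W" "W1 \<noteq> {}" "card (nbhd M W W1) \<le> k" "W1 \<union> nbhd M W W1 \<noteq> W"
      unfolding robust_def by blast
    define Y where "Y = nbhd M W W1"
    define W2 where "W2 = W - W1 - Y"
    have YW: "Y \<subseteq> W" "Y \<inter> W1 = {}" by (auto simp: Y_def nbhd_def)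
    have W2: "W2 \<subseteq> W" "W2 \<noteq> {}" "W1 \<inter> W2 = {}" "Y \<inter> W2 = {}"
      using W1 YW by (auto simp: W2_def Y_def)
    have W_eq: "W = W1 \<union> W2 \<union> Y" using W1(1) YW by (auto simp: W2_def)
    have nonadj: "\<not> M x y" "\<not> M y x" if "x \<in> W1" "y \<in> W2" for x y
      using that sympD[OF sym, of y x] by (auto simp: W2_def Y_def nbhd_def)
    have fin12: "finite W1" "finite W2" using fin W1(1) W2(1) finite_subset by auto
    \<comment> \<open>The exact independence number of \<open>W1\<close>, since then
      \<open>b - b1\<close> bounds that of \<open>W2\<close>: independent sets of the two sides
      unite to an independent set.\<close>
    define b1 where "b1 = Max (card ` {S. S \<subseteq> W1 \<and> indep M S})"
    have fS: "finite {S. S \<subseteq> W1 \<and> indep M S}" using fin12(1) by simp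
    have "{} \<in> {S. S \<subseteq> W1 \<and> indep M S}" by (simp add: indep_def)
    then have "b1 \<in> card ` {S. S \<subseteq> W1 \<and> indep M S}"
      unfolding b1_def using fS by (intro Max_in) auto
    then obtain S1 where S1: "S1 \<subseteq> W1" "indep M S1" "card S1 = b1" by auto
    have le1: "card S \<le> b1" if "S \<subseteq> W1" "indep M S" for S
      unfolding b1_def using that fS by (intro Max_ge) auto
    have sum: "b1 + card S \<le> b" if S: "S \<subseteq> W2" "indep M S" for S
    proof -
      have "indep M (S1 \<union> S)"
        using S S1 nonadj unfolding indep_def by blast
      moreover have "S1 \<union> S \<subseteq> W" using S S1 W1 W2 by blast
      moreover have "card (S1 \<union> S) = card S1 + card S"
        using S S1 W2(3) fin12 by (intro card_Un_disjoint) (auto intro: finite_subset)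
      ultimately show ?thesis using alpha S1(3) unfolding alpha_le_def by metis
    qed
    \<comment> \<open>Both sides are nonempty, so both parameters are positive and hence both are
      smaller than \<open>b\<close>.\<close>
    obtain x1 x2 where x: "x1 \<in> W1" "x2 \<in> W2" using W1(2) W2(2) by blast
    have b1: "1 \<le> b1" using le1[of "{x1}"] x sing by simp
    have b2: "b1 + 1 \<le> b" using sum[of "{x2}"] x sing by simp
    define b2 where "b2 = b - b1"
    have bb: "b = b1 + b2" "1 \<le> b2" "b1 < b" "b2 < b" using b1 b2 by (auto simp: b2_def)
    have "alpha_le M W1 b1" unfolding alpha_le_def using le1 by blast
    from less.IH[OF bb(3) fin12(1) this] obtain X1 \<A>1 where
      D1: "X1 \<subseteq> W1" "\<Union>\<A>1 = W1 - X1" "pairwise disjnt \<A>1"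
      "\<forall>A\<in>\<A>1. robust M k A \<and> m \<le> card A"
      "\<forall>A\<in>\<A>1. \<forall>B\<in>\<A>1. A \<noteq> B \<longrightarrow> (\<forall>x\<in>A. \<forall>y\<in>B. \<not> M x y)"
      "card X1 + 2 * card \<A>1 \<le> (b1 - 1) * k + b1 * m"
      by (elim exE conjE) (rule that)
    have "card S \<le> b2" if "S \<subseteq> W2" "indep M S" for S using sum[OF that] bb(1) by linarith
    then have "alpha_le M W2 b2" unfolding alpha_le_def by blast
    from less.IH[OF bb(4) fin12(2) this] obtain X2 \<A>2 where
      D2: "X2 \<subseteq> W2" "\<Union>\<A>2 = W2 - X2" "pairwise disjnt \<A>2"
      "\<forall>A\<in>\<A>2. robust M k A \<and> m \<le> card A"
      "\<forall>A\<in>\<A>2. \<forall>B\<in>\<A>2. A \<noteq> B \<longrightarrow> (\<forall>x\<in>A. \<forall>y\<in>B. \<not> M x y)"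
      "card X2 + 2 * card \<A>2 \<le> (b2 - 1) * k + b2 * m"
      by (elim exE conjE) (rule that)
    have sub: "A \<subseteq> W1" if "A \<in> \<A>1" for A using that D1(2) by blast
    have sub2: "A \<subseteq> W2" if "A \<in> \<A>2" for A using that D2(2) by blast
    have u: "\<Union>(\<A>1 \<union> \<A>2) = W - (X1 \<union> X2 \<union> Y)"
    proof -
      have "\<Union>(\<A>1 \<union> \<A>2) = (W1 - X1) \<union> (W2 - X2)" using D1(2) D2(2) by simp
      also have "\<dots> = W - (X1 \<union> X2 \<union> Y)" using W_eq W2 YW D1(1) D2(1) by blast
      finally show ?thesis .
    qed
    have d: "pairwise disjnt (\<A>1 \<union> \<A>2)"
    proof (rule pairwiseI)
      fix A B assume AB: "A \<in> \<A>1 \<union> \<A>2" "B \<in> \<A>1 \<union> \<A>2" "A \<noteq> B"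
      consider "A \<in> \<A>1" "B \<in> \<A>1" | "A \<in> \<A>2" "B \<in> \<A>2"
        | "A \<subseteq> W1" "B \<subseteq> W2" | "A \<subseteq> W2" "B \<subseteq> W1"
        using AB sub sub2 by blast
      then show "disjnt A B"
      proof cases
        case 1
        with \<open>pairwise disjnt \<A>1\<close> show ?thesis using AB(3) by (rule pairwiseD)
      next
        case 2
        with \<open>pairwise disjnt \<A>2\<close> show ?thesis using AB(3) by (rule pairwiseD)
      qed (use W2(3) in \<open>auto simp: disjnt_def\<close>)
    qed
    have n: "\<forall>A\<in>\<A>1 \<union> \<A>2. \<forall>B\<in>\<A>1 \<union> \<A>2. A \<noteq> B \<longrightarrow> (\<forall>x\<in>A. \<forall>y\<in>B. \<not> M x y)"
    proof (intro ballI impI)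
      fix A B x y assume AB: "A \<in> \<A>1 \<union> \<A>2" "B \<in> \<A>1 \<union> \<A>2" "A \<noteq> B" "x \<in> A" "y \<in> B"
      consider "A \<in> \<A>1" "B \<in> \<A>1" | "A \<in> \<A>2" "B \<in> \<A>2"
        | "x \<in> W1" "y \<in> W2" | "x \<in> W2" "y \<in> W1"
        using AB sub sub2 by blast
      then show "\<not> M x y"
      proof cases
        case 1
        from D1(5)[rule_format, OF this AB(3-5)] show ?thesis .
      next
        case 2
        from D2(5)[rule_format, OF this AB(3-5)] show ?thesis .
      qed (auto simp: nonadj)
    qed
    have "card (X1 \<union> X2 \<union> Y) \<le> card X1 + card X2 + card Y"
      by (meson add_le_mono1 card_Un_le le_trans)
    moreover have "card (\<A>1 \<union> \<A>2) \<le> card \<A>1 + card \<A>2" by (rule card_Un_le)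
    moreover have "card Y \<le> k" using W1(3) by (simp add: Y_def)
    \<comment> \<open>Replacing \<open>b - 1\<close> by \<open>(b1 - 1) + (b2 - 1)\<close> saves one
      \<open>k\<close>, which pays for \<open>Y\<close>.\<close>
    moreover have "(b1 - 1) * k + b1 * m + ((b2 - 1) * k + b2 * m) + k = (b - 1) * k + b * m"
    proof -
      obtain c1 c2 where "b1 = Suc c1" "b2 = Suc c2"
        using b1 bb(2) by (metis One_nat_def Suc_le_D)
      then show ?thesis by (simp add: bb(1) algebra_simps)
    qed
    ultimately have c: "card (X1 \<union> X2 \<union> Y) + 2 * card (\<A>1 \<union> \<A>2) \<le> (b - 1) * k + b * m"
      using D1(6) D2(6) by linarith
    have r: "\<forall>A\<in>\<A>1 \<union> \<A>2. robust M k A \<and> m \<le> card A" using D1(4) D2(4) by blast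
    have "X1 \<union> X2 \<union> Y \<subseteq> W" using D1(1) D2(1) W1(1) W2(1) YW(1) by blast
    then show ?thesis using u d r n c by (intro exI[of _ "X1 \<union> X2 \<union> Y"] exI[of _ "\<A>1 \<union> \<A>2"] conjI)
  qed
qed

section \<open>Path covers\<close>

text \<open>The last position always counts as a break.\<close>

definition breaks :: "('a \<Rightarrow> 'a \<Rightarrow> bool) \<Rightarrow> 'a list \<Rightarrow> nat set" where
  "breaks R xs = {i. i < length xs \<and> \<not> (Suc i < length xs \<and> R (xs ! i) (xs ! Suc i))}"

text \<open>
  The maximal runs without breaks form a path cover. Any end of a longest path has no neighbours
  outside the path, so that removing the path decreases the independence number.
\<close>

lemma path_cover:
  assumes sym: "symp R" and irr: "\<And>x. \<not> R x x"
    and "finite W" "alpha_le R W b"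
  shows "\<exists>xs. distinct xs \<and> set xs = W \<and> card (breaks R xs) \<le> b"
  using assms(3,4)
proof (induction b arbitrary: W)
  case 0
  have "W = {}"
  proof (rule ccontr)
    assume "W \<noteq> {}"
    then obtain x where "x \<in> W" by blast
    then show False using 0 irr unfolding alpha_le_def
      by (metis card.empty card_insert_disjoint empty_iff finite.emptyI indep_def insert_subset le_zero_eq nat.distinct(1) singletonD empty_subsetI)
  qed
  then show ?case by (intro exI[of _ "[]"]) (auto simp: breaks_def)
next
  case (Suc b)
  show ?case
  proof (cases "W = {}")
    case True
    then show ?thesis by (intro exI[of _ "[]"]) (auto simp: breaks_def)
  next
    case False
    then obtain w where w: "w \<in> W" by blast
    define good where "good P \<longleftrightarrow> P \<noteq> [] \<and> distinct P \<and> set P \<subseteq> W \<and> successively R P" for P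
    have "good [w]" using w by (simp add: good_def)
    moreover have "length P \<le> card W" if "good P" for P
      using that Suc.prems(1) unfolding good_def by (metis card_mono distinct_card)
    ultimately obtain P where P: "good P" and max: "\<And>Q. good Q \<Longrightarrow> length Q \<le> length P"
      using ex_has_greatest_nat[of good "[w]" length "Suc (card W)"] le_imp_less_Suc by blast
    define W' where "W' = W - set P"
    have nonadj: "\<not> R (hd P) x" if "x \<in> W'" for x
    proof
      assume "R (hd P) x"
      then have "good (x # P)"
        using P that sympD[OF sym, of "hd P" x] unfolding good_def W'_def by (auto simp: successively_Cons)
      from max[OF this] show False by simp
    qed
    have hdP: "hd P \<in> W" "hd P \<in> set P" using P by (auto simp: good_def)
    have "alpha_le R W' b"
      unfolding alpha_le_def
    proof (intro allI impI)
      fix S assume S: "S \<subseteq> W'" "indep R S"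
      have "indep R (insert (hd P) S)"
        using S nonadj irr sympD[OF sym] unfolding indep_def by blast
      moreover have "insert (hd P) S \<subseteq> W" using S hdP by (auto simp: W'_def)
      ultimately have "card (insert (hd P) S) \<le> Suc b" using Suc.prems(2) unfolding alpha_le_def by blast
      moreover have "hd P \<notin> S" "finite S"
        using S hdP Suc.prems(1) by (auto simp: W'_def intro: finite_subset)
      ultimately show "card S \<le> b" by simp
    qed
    moreover have "finite W'" using Suc.prems(1) by (simp add: W'_def)
    ultimately obtain xs where xs: "distinct xs" "set xs = W'" "card (breaks R xs) \<le> b"
      using Suc.IH by blast
    \<comment> \<open>Prepending \<open>P\<close> adds at most one break, at its last vertex; the
      junction with \<open>xs\<close> is counted whether or not its two vertices are
      related.\<close>
    have "breaks R (P @ xs) \<subseteq> insert (length P - 1) ((+) (length P) ` breaks R xs)"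
    proof
      fix i assume i: "i \<in> breaks R (P @ xs)"
      consider "Suc i < length P" | "i = length P - 1" | "length P \<le> i" by linarith
      then show "i \<in> insert (length P - 1) ((+) (length P) ` breaks R xs)"
      proof cases
        case 1
        then have "R (P ! i) (P ! Suc i)" using P unfolding good_def by (auto simp: successively_conv_nth)
        then show ?thesis using 1 i by (auto simp: breaks_def nth_append)
      next
        case 3
        then have "i - length P \<in> breaks R xs"
          using i by (auto simp: breaks_def nth_append Suc_diff_le)
        then show ?thesis using 3 by force
      qed auto
    qed
    moreover have "finite (breaks R xs)" by (simp add: breaks_def)
    ultimately have "card (breaks R (P @ xs)) \<le> card (insert (length P - 1) ((+) (length P) ` breaks R xs))"
      by (intro card_mono) auto
    also have "\<dots> \<le> Suc (card ((+) (length P) ` breaks R xs))" by (rule card_insert_le_m1) auto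
    also have "\<dots> \<le> Suc b" using xs(3) card_image_le[of "breaks R xs" "(+) (length P)"] \<open>finite (breaks R xs)\<close> by simp
    finally show ?thesis
      using xs P unfolding good_def by (intro exI[of _ "P @ xs"]) (auto simp: W'_def)
  qed
qed

section \<open>The graph of blocks\<close>

text \<open>
  Two neighbours are required so that the entry and the exit of a path through a large block can be
  chosen distinct.
\<close>

definition attached :: "('a \<Rightarrow> 'a \<Rightarrow> bool) \<Rightarrow> 'a \<Rightarrow> 'a set \<Rightarrow> bool" where
  "attached M x C \<longleftrightarrow> (if is_singleton C then \<forall>z\<in>C. M x z else 2 \<le> card {z \<in> C. M x z})"

text \<open>Two large blocks are never adjacent. So every edge has a singleton end, whose vertex
  serves as both entry and exit, and only the port in the other block has to be chosen. The
  disjunction makes the relation symmetric.\<close>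

definition block_adj :: "('a \<Rightarrow> 'a \<Rightarrow> bool) \<Rightarrow> 'a set \<Rightarrow> 'a set \<Rightarrow> bool" where
  "block_adj M B C \<longleftrightarrow> B \<noteq> C \<and>
     ((\<exists>x. B = {x} \<and> attached M x C) \<or> (\<exists>y. C = {y} \<and> attached M y B))"

lemma block_adj_singleton:
  assumes "symp M" "block_adj M B {y}"
  shows "attached M y B"
  using assms unfolding block_adj_def attached_def
  by (auto simp: is_singleton_def symp_def)

text \<open>Independent blocks have independent representatives. A singleton to which a large block
  is not attached has at most one neighbour in it, so at most \<open>a\<close> singletons cannot
  cover its more than \<open>a\<close> vertices. Two large blocks have no edges between them by
  assumption.\<close>

lemma alpha_le_block_adj:
  assumes sym: "symp M" and irr: "\<And>x. \<not> M x x" and alpha: "alpha_le M V a"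
    and fin: "finite \<B>" and disj: "pairwise disjnt \<B>" and sub: "\<Union>\<B> \<subseteq> V"
    and size: "\<And>B. B \<in> \<B> \<Longrightarrow> is_singleton B \<or> a < card B"
    and nonadj: "\<And>A B x y. A \<in> \<B> \<Longrightarrow> B \<in> \<B> \<Longrightarrow> \<not> is_singleton A \<Longrightarrow> \<not> is_singleton B \<Longrightarrow>
        A \<noteq> B \<Longrightarrow> x \<in> A \<Longrightarrow> y \<in> B \<Longrightarrow> \<not> M x y"
  shows "alpha_le (block_adj M) \<B> a"
proof (rule ccontr)
  assume "\<not> alpha_le (block_adj M) \<B> a"
  then obtain I0 where I0: "I0 \<subseteq> \<B>" "indep (block_adj M) I0" "a < card I0"
    unfolding alpha_le_def by (auto simp: not_le)
  \<comment> \<open>Exactly \<open>a + 1\<close> blocks are kept, so that at most \<open>a\<close>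
    of them are singletons as soon as one is large.\<close>
  then obtain I where I: "I \<subseteq> I0" "card I = Suc a"
    using obtain_subset_with_card_n[of "Suc a" I0] by (metis Suc_leI)
  have finI: "finite I" using I(2) card.infinite by force
  define xs where "xs = {x. {x} \<in> I}"
  have IB: "I \<subseteq> \<B>" using I I0 by blast
  have non: "\<not> block_adj M B C" if "B \<in> I" "C \<in> I" for B C
    using I0(2) I(1) that unfolding indep_def by blast
  have "\<exists>z\<in>B. \<not> is_singleton B \<longrightarrow> (\<forall>x\<in>xs. \<not> M x z)" if B: "B \<in> I" for B
  proof (cases "is_singleton B")
    case True
    then show ?thesis by (auto simp: is_singleton_def)
  next
    case False
    have cB: "a < card B" using size[of B] B IB False by blast
    then have finB: "finite B" using card.infinite by force
    define N where "N x = {z \<in> B. M x z}" for x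
    have fxs: "finite xs" and cxs: "card xs \<le> a"
    proof -
      have s: "(\<lambda>x. {x}) ` xs \<subseteq> I - {B}" using False by (auto simp: xs_def)
      show "finite xs"
        by (rule finite_imageD[of "\<lambda>x. {x}"]) (use s finI in \<open>auto intro: finite_subset\<close>)
      have "card xs = card ((\<lambda>x. {x}) ` xs)" by (simp add: card_image)
      also have "\<dots> \<le> card (I - {B})" using s finI by (intro card_mono) auto
      also have "\<dots> = a" using I(2) B by simp
      finally show "card xs \<le> a" .
    qed
    have "card (N x) \<le> 1" if "x \<in> xs" for x
    proof -
      have "{x} \<noteq> B" using False by (auto simp: is_singleton_def)
      then have "\<not> attached M x B" using non[of "{x}" B] B that unfolding block_adj_def xs_def by blast
      then show ?thesis using False by (simp add: attached_def N_def)
    qed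
    then have "card (\<Union>(N ` xs)) \<le> card xs"
      using card_UN_le[OF fxs, of N] sum_bounded_above[of xs "\<lambda>x. card (N x)" 1] by simp
    then have "card (\<Union>(N ` xs)) < card B" using cxs cB by linarith
    then have "\<not> B \<subseteq> \<Union>(N ` xs)"
      using card_mono[of "\<Union>(N ` xs)" B] fxs finB by (auto simp: N_def not_le[symmetric])
    then show ?thesis unfolding N_def by blast
  qed
  then obtain f where f: "\<And>B. B \<in> I \<Longrightarrow> f B \<in> B"
    "\<And>B x. B \<in> I \<Longrightarrow> \<not> is_singleton B \<Longrightarrow> x \<in> xs \<Longrightarrow> \<not> M x (f B)" by metis
  have "inj_on f I"
  proof (rule inj_onI)
    fix B C assume BC: "B \<in> I" "C \<in> I" "f B = f C"
    then show "B = C"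
      using f(1)[of B] f(1)[of C] pairwiseD[OF disj, of B C] IB by (auto simp: disjnt_iff)
  qed
  then have "card (f ` I) = Suc a" using I(2) by (simp add: card_image)
  moreover have "f ` I \<subseteq> V" using f(1) IB sub by blast
  moreover have "indep M (f ` I)"
    unfolding indep_def
  proof (intro ballI)
    fix u v assume "u \<in> f ` I" "v \<in> f ` I"
    then obtain B C where BC: "B \<in> I" "C \<in> I" and u: "u = f B" and v: "v = f C" by blast
    have *: "\<not> M (f B) (f C)" if BC: "B \<in> I" "C \<in> I" and sB: "is_singleton B" for B C
    proof (cases "is_singleton C")
      case True
      then obtain x y where xy: "B = {x}" "C = {y}" using sB by (auto simp: is_singleton_def)
      then have "f B = x" "f C = y" using f(1) BC by auto
      moreover have "B \<noteq> C \<Longrightarrow> \<not> M x y"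
        using non[OF BC] xy by (auto simp: block_adj_def attached_def)
      ultimately show ?thesis using irr xy by auto
    next
      case False
      obtain x where x: "B = {x}" using sB by (auto simp: is_singleton_def)
      then have "f B = x" "x \<in> xs" using f(1)[OF BC(1)] BC(1) by (auto simp: xs_def)
      then show ?thesis using f(2)[OF BC(2) False] by simp
    qed
    show "\<not> M u v"
    proof (cases "is_singleton B \<or> is_singleton C")
      case True
      then show ?thesis using *[OF BC] *[OF BC(2,1)] sympD[OF sym] u v by blast
    next
      case False
      then show ?thesis
        using nonadj[of B C "f B" "f C"] BC IB f(1)[OF BC(1)] f(1)[OF BC(2)] irr u v by auto
    qed
  qed
  ultimately have "Suc a \<le> a" using alpha unfolding alpha_le_def by metis
  then show False by simp
qed

section \<open>Short links\<close>

definition mutual :: "('a \<Rightarrow> 'a \<Rightarrow> bool) \<Rightarrow> 'a \<Rightarrow> 'a \<Rightarrow> bool" where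
  "mutual E x y \<longleftrightarrow> E x y \<and> E y x"

text \<open>The reachability part of \<open>k_connected\<close> for a bare relation; the bound on
  the number of vertices is stated separately.\<close>

definition k_connected_rel :: "('a \<Rightarrow> 'a \<Rightarrow> bool) \<Rightarrow> 'a set \<Rightarrow> nat \<Rightarrow> bool" where
  "k_connected_rel E V K \<longleftrightarrow> (\<forall>X\<subseteq>V. card X < K \<longrightarrow> (\<forall>u\<in>V - X. \<forall>v\<in>V - X.
     (\<lambda>x y. E x y \<and> x \<in> V - X \<and> y \<in> V - X)\<^sup>*\<^sup>* u v))"

text \<open>On a geodesic that avoids \<open>X\<close>, vertices at even positions are pairwise not
  mutual, because the forward arc would be a shortcut. So there are at most \<open>a\<close> of
  them, and at most \<open>2 * a\<close> vertices including \<open>u\<close> and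
  \<open>v\<close>.\<close>

lemma short_link:
  assumes irr: "\<And>x. \<not> E x x" and conn: "k_connected_rel E V K" and alpha: "alpha_le (mutual E) V a"
    and X: "X \<subseteq> V" "card X < K" and uv: "u \<in> V - X" "v \<in> V - X" "u \<noteq> v"
  obtains ys where "successively E (u # ys @ [v])" "distinct ys" "set ys \<subseteq> V - X - {u, v}"
    "length ys \<le> 2 * a - 2"
proof -
  define R where "R x y \<longleftrightarrow> E x y \<and> x \<in> V - X \<and> y \<in> V - X" for x y
  have "R\<^sup>*\<^sup>* u v" using conn X uv unfolding k_connected_rel_def R_def by blast
  then obtain xs where xs: "xs \<noteq> []" "hd xs = u" "last xs = v" "successively R xs" "distinct xs"
    and geo: "\<forall>i j. i + 1 < j \<longrightarrow> j < length xs \<longrightarrow> \<not> R (xs ! i) (xs ! j)"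
    by (rule geodesic_exists)
  have mem: "x \<in> V - X" if "x \<in> set xs" for x
  proof -
    have "R\<^sup>*\<^sup>* u x" using successively_imp_rtranclp[OF xs(4) that] xs(2) by simp
    then show ?thesis using uv(1) by induction (auto simp: R_def)
  qed
  \<comment> \<open>The even positions, their number rounded up; thus \<open>card I \<le> a\<close>
    gives length at most \<open>2 * a\<close> for either parity.\<close>
  define I where "I = {..<(length xs + 1) div 2}"
  define S where "S = (\<lambda>i. xs ! (2 * i)) ` I"
  have lt: "2 * i < length xs" if "i \<in> I" for i using that by (auto simp: I_def)
  have "card S = card I"
    unfolding S_def using xs(5) lt by (intro card_image) (auto simp: inj_on_def nth_eq_iff_index_eq)
  moreover have "S \<subseteq> V" using mem lt unfolding S_def by auto
  moreover have "indep (mutual E) S"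
  proof -
    have *: "\<not> mutual E (xs ! (2 * i)) (xs ! (2 * j)) \<and> \<not> mutual E (xs ! (2 * j)) (xs ! (2 * i))"
      if "i \<in> I" "j \<in> I" "i < j" for i j
    proof -
      have "\<not> R (xs ! (2 * i)) (xs ! (2 * j))" using geo lt that by simp
      then show ?thesis using mem lt that unfolding R_def mutual_def by auto
    qed
    have "\<not> mutual E (xs ! (2 * i)) (xs ! (2 * j))" if "i \<in> I" "j \<in> I" for i j
      using *[of i j] *[of j i] that irr unfolding mutual_def by (metis nat_neq_iff)
    then show ?thesis unfolding indep_def S_def by blast
  qed
  ultimately have "card I \<le> a" using alpha unfolding alpha_le_def by metis
  then have len: "length xs \<le> 2 * a" by (simp add: I_def)
  obtain ys where ys: "xs = u # ys @ [v]"
    using xs(1-3) uv(3) by (metis append_butlast_last_id last_ConsL list.collapse list.sel(1) last_tl)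
  have "successively E (u # ys @ [v])"
    using xs(4) unfolding ys[symmetric] by (rule successively_mono) (auto simp: R_def)
  moreover have "set ys \<subseteq> V - X - {u, v}" using mem xs(5) unfolding ys by auto
  ultimately show ?thesis using xs(5) len unfolding ys by (intro that[of ys]) auto
qed

text \<open>The links are found one after another, each avoiding \<open>F\<close> and the inner
  vertices of the earlier ones. A pair joined by an arc gets the empty link, so only the other pairs
  are charged \<open>2 * a - 2\<close> vertices.\<close>

lemma disjoint_short_links:
  fixes n :: nat
  assumes irr: "\<And>x. \<not> E x x" and conn: "k_connected_rel E V K" and alpha: "alpha_le (mutual E) V a"
    and fin: "finite V" and F: "F \<subseteq> V"
    and uv: "\<And>i. i < n \<Longrightarrow> u i \<in> F \<and> v i \<in> F \<and> u i \<noteq> v i"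
    and card: "card F + card {i. i < n \<and> \<not> E (u i) (v i)} * (2 * a - 2) < K"
  shows "\<exists>ys. (\<forall>i<n. successively E (u i # ys i @ [v i]) \<and> distinct (ys i) \<and> set (ys i) \<subseteq> V - F) \<and>
     (\<forall>i<n. \<forall>j<n. i \<noteq> j \<longrightarrow> set (ys i) \<inter> set (ys j) = {}) \<and>
     card (\<Union>i<n. set (ys i)) \<le> card {i. i < n \<and> \<not> E (u i) (v i)} * (2 * a - 2)"
  using uv card
proof (induction n)
  case 0
  show ?case by simp
next
  case (Suc n)
  define J where "J m = {i. i < m \<and> \<not> E (u i) (v i)}" for m
  have finJ: "finite (J m)" for m by (simp add: J_def)
  have "card (J n) \<le> card (J (Suc n))" by (intro card_mono finJ) (auto simp: J_def)
  then have le: "card (J n) * (2 * a - 2) \<le> card (J (Suc n)) * (2 * a - 2)" by (rule mult_le_mono1)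
  then have "card F + card (J n) * (2 * a - 2) < K" using Suc.prems(2) unfolding J_def by linarith
  then have "\<exists>ys. (\<forall>i<n. successively E (u i # ys i @ [v i]) \<and> distinct (ys i) \<and> set (ys i) \<subseteq> V - F) \<and>
     (\<forall>i<n. \<forall>j<n. i \<noteq> j \<longrightarrow> set (ys i) \<inter> set (ys j) = {}) \<and>
     card (\<Union>i<n. set (ys i)) \<le> card (J n) * (2 * a - 2)"
    unfolding J_def by (rule Suc.IH[rotated]) (simp add: Suc.prems(1))
  then obtain ys where
    1: "\<forall>i<n. successively E (u i # ys i @ [v i]) \<and> distinct (ys i) \<and> set (ys i) \<subseteq> V - F"
    and 2: "\<forall>i<n. \<forall>j<n. i \<noteq> j \<longrightarrow> set (ys i) \<inter> set (ys j) = {}"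
    and 3: "card (\<Union>i<n. set (ys i)) \<le> card (J n) * (2 * a - 2)"
    by (elim exE conjE)
  define L where "L = (\<Union>i<n. set (ys i))"
  have LV: "L \<subseteq> V - F" using 1 unfolding L_def by blast
  have uvn: "u n \<in> F" "v n \<in> F" "u n \<noteq> v n" using Suc.prems(1) by auto
  obtain zs where zs: "successively E (u n # zs @ [v n])" "distinct zs" "set zs \<subseteq> V - F - L"
    "card (L \<union> set zs) \<le> card (J (Suc n)) * (2 * a - 2)"
  proof (cases "E (u n) (v n)")
    case True
    then show ?thesis using that[of "[]"] 3 le unfolding L_def[symmetric] by simp
  next
    case False
    then have "J (Suc n) = insert n (J n)" "n \<notin> J n" by (auto simp: J_def less_Suc_eq)
    then have cJ: "card (J (Suc n)) = Suc (card (J n))" using finJ by simp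
    \<comment> \<open>The two ends lie in \<open>F\<close> but must remain available to the
      geodesic.\<close>
    define Y where "Y = (F \<union> L) - {u n, v n}"
    have YV: "Y \<subseteq> V" using F LV by (auto simp: Y_def)
    have "card Y \<le> card (F \<union> L)"
      using F LV fin by (intro card_mono) (auto simp: Y_def intro: finite_subset)
    also have "\<dots> \<le> card F + card L" by (rule card_Un_le)
    also have "\<dots> < K" using 3 Suc.prems(2) le unfolding L_def J_def by linarith
    finally have "card Y < K" .
    then obtain zs where zs: "successively E (u n # zs @ [v n])" "distinct zs"
        "set zs \<subseteq> V - Y - {u n, v n}" "length zs \<le> 2 * a - 2"
      using short_link[OF irr conn alpha YV, of "u n" "v n"] uvn F unfolding Y_def by blast
    have "card (L \<union> set zs) \<le> card L + length zs"
      using card_Un_le[of L "set zs"] card_length[of zs] by linarith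
    then show ?thesis using that[OF zs(1,2)] zs(3,4) 3 cJ uvn unfolding L_def[symmetric] Y_def by auto
  qed
  define ys' where "ys' = ys(n := zs)"
  have U: "(\<Union>i<Suc n. set (ys' i)) = L \<union> set zs"
    by (auto simp: ys'_def L_def lessThan_Suc)
  have "set (ys' i) \<inter> set (ys' j) = {}" if "i < Suc n" "j < Suc n" "i \<noteq> j" for i j
    using that 2[rule_format, of i j] zs(3) unfolding ys'_def L_def by (fastforce simp: less_Suc_eq)
  moreover have "successively E (u i # ys' i @ [v i]) \<and> distinct (ys' i) \<and> set (ys' i) \<subseteq> V - F" if "i < Suc n" for i
    using that 1[rule_format, of i] zs(1-3) by (cases "i = n") (auto simp: ys'_def)
  ultimately show ?case using zs(4) U unfolding J_def[symmetric] by (intro exI[of _ ys']) auto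
qed

section \<open>Assembling the Hamilton cycle\<close>

lemma distinct_concat_upt:
  assumes "\<forall>i<n. distinct (c i)" "\<forall>i<n. \<forall>j<n. i \<noteq> j \<longrightarrow> set (c i) \<inter> set (c j) = {}"
  shows "distinct (concat (map c [0..<n]))"
  using assms
proof (induction n)
  case (Suc n)
  have IH: "distinct (concat (map c [0..<n]))"
  proof (rule Suc.IH)
    show "\<forall>i<n. distinct (c i)" using Suc.prems(1) by simp
    show "\<forall>i<n. \<forall>j<n. i \<noteq> j \<longrightarrow> set (c i) \<inter> set (c j) = {}" using Suc.prems(2) by simp
  qed
  have "set (c i) \<inter> set (c n) = {}" if "i < n" for i
    using Suc.prems(2)[rule_format, of i n] that by simp
  then have "set (concat (map c [0..<n])) \<inter> set (c n) = {}" by fastforce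
  then show ?case using IH Suc.prems(1) by simp
qed simp

lemma successively_concat_upt:
  assumes "\<forall>i<n. c i \<noteq> [] \<and> successively E (c i)"
    and "\<forall>i. Suc i < n \<longrightarrow> E (last (c i)) (hd (c (Suc i)))" and "0 < n"
  shows "successively E (concat (map c [0..<n])) \<and> concat (map c [0..<n]) \<noteq> [] \<and>
    hd (concat (map c [0..<n])) = hd (c 0) \<and> last (concat (map c [0..<n])) = last (c (n - 1))"
  using assms
proof (induction n)
  case (Suc n)
  show ?case
  proof (cases "n = 0")
    case True
    then show ?thesis using Suc.prems(1) by simp
  next
    case False
    then have IH: "successively E (concat (map c [0..<n])) \<and> concat (map c [0..<n]) \<noteq> [] \<and>
      hd (concat (map c [0..<n])) = hd (c 0) \<and> last (concat (map c [0..<n])) = last (c (n - 1))"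
      using Suc.IH Suc.prems(1,2) by simp
    have "E (last (c (n - 1))) (hd (c n))" using Suc.prems(2)[rule_format, of "n - 1"] False by simp
    then have "successively E (concat (map c [0..<n]) @ c n)"
      using IH Suc.prems(1) by (auto simp: successively_append_iff simp del: concat_eq_Nil_conv)
    moreover have "c n \<noteq> []" using Suc.prems(1) by simp
    moreover have "concat (map c [0..<Suc n]) = concat (map c [0..<n]) @ c n" by simp
    ultimately show ?thesis using IH by (simp only: hd_append2 last_appendR diff_Suc_1) simp
  qed
qed simp

text \<open>\<open>S\<close> and \<open>T\<close> are the admissible entries and exits of the block
  \<open>B\<close>. In a large block, any choice of \<open>s\<close> leaves another element of
  \<open>T\<close>.\<close>

lemma choose_ports:
  assumes "B \<noteq> {}" and "if is_singleton B then S = B \<and> T = B else 2 \<le> card S \<and> 2 \<le> card T"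
  shows "\<exists>s\<in>S. \<exists>t\<in>T. s = t \<longleftrightarrow> is_singleton B"
proof (cases "is_singleton B")
  case True
  then show ?thesis using assms by auto
next
  case False
  then have c: "2 \<le> card S" "2 \<le> card T" using assms(2) by auto
  have "S \<noteq> {}" using c(1) by auto
  then obtain s where s: "s \<in> S" by blast
  have "finite T" using c(2) card.infinite by force
  then have "0 < card (T - {s})" using c(2) by (simp add: card_Diff_singleton_if)
  then have "T - {s} \<noteq> {}" by force
  then obtain t where "t \<in> T - {s}" by blast
  with s False show ?thesis by (intro bexI[of _ s] bexI[of _ t]) auto
qed

text \<open>The list of blocks, path after path, is read cyclically. Block \<open>i\<close>
  contributes a path from its entry \<open>s i\<close> to its exit \<open>t i\<close>, followed by a
  link to the entry of the next block.\<close>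

lemma hamilton_cycle_list:
  assumes fin: "finite V" and irr: "\<And>x. \<not> E x x"
    and card_V: "2 * a ^ 3 + 2 < card V" and conn: "k_connected_rel E V (2 * a ^ 3 + 2)"
    and alpha: "alpha_le (mutual E) V a"
  shows "\<exists>p. p \<noteq> [] \<and> distinct p \<and> set p = V \<and> successively E p \<and> E (last p) (hd p)"
proof -
  define M where "M = mutual E"
  have sym: "symp M" by (auto simp: M_def mutual_def symp_def)
  have irrM: "\<not> M x x" for x using irr by (simp add: M_def mutual_def)
  have ME: "E x y" if "M x y" for x y using that by (simp add: M_def mutual_def)
  have alphaM: "alpha_le M V a" using alpha by (simp add: M_def)
  have "V \<noteq> {}" using card_V by auto
  then obtain v0 where "v0 \<in> V" by blast
  then have "{v0} \<subseteq> V" "indep M {v0}" using irrM by (auto simp: indep_def)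
  then have a: "1 \<le> a" using alphaM unfolding alpha_le_def by force
  \<comment> \<open>A bound for all inner vertices of links: at most \<open>a\<close> breaks, each
    with at most \<open>2 * a - 2\<close> vertices.\<close>
  define l where "l = a * (2 * a - 2)"
  \<comment> \<open>Robustness \<open>a + l\<close> leaves robustness \<open>a\<close> after the
    deletion of \<open>l\<close> vertices. Size \<open>a + 1\<close> is what the independence bound
    for \<open>block_adj\<close> asks of large blocks.\<close>
  obtain X \<A> where XA: "X \<subseteq> V" "\<Union>\<A> = V - X" "pairwise disjnt \<A>"
    "\<forall>A\<in>\<A>. robust M (a + l) A \<and> a + 1 \<le> card A"
    "\<forall>A\<in>\<A>. \<forall>B\<in>\<A>. A \<noteq> B \<longrightarrow> (\<forall>x\<in>A. \<forall>y\<in>B. \<not> M x y)"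
    "card X + 2 * card \<A> \<le> (a - 1) * (a + l) + a * (a + 1)"
    using robust_decomposition[OF sym irrM _ fin alphaM, of "a + 1" "a + l"] a
    by (elim meta_impE exE conjE) (simp, rule that)
  \<comment> \<open>With the bound of the decomposition inserted, the left side is exactly
    \<open>2 * a ^ 3\<close>.\<close>
  have budget: "card X + 2 * card \<A> + l < 2 * a ^ 3 + 2"
  proof -
    obtain c where c: "a = Suc c" using a by (metis One_nat_def Suc_le_D)
    have "(a - 1) * (a + l) + a * (a + 1) + l < 2 * a ^ 3 + 2"
      unfolding l_def c by (simp add: algebra_simps power3_eq_cube)
    then show ?thesis using XA(6) by linarith
  qed
  define \<B> where "\<B> = (\<lambda>x. {x}) ` X \<union> \<A>"
  have AV: "A \<subseteq> V" "A \<inter> X = {}" if "A \<in> \<A>" for A using that XA(2) by blast+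
  have cA: "a + 1 \<le> card A" if "A \<in> \<A>" for A using that XA(4) by blast
  have nsA: "\<not> is_singleton A" if "A \<in> \<A>" for A
    using cA[OF that] a by (auto simp: is_singleton_altdef)
  have finA: "finite \<A>" using XA(2) fin by (metis finite_Diff finite_UnionD)
  have finX: "finite X" using XA(1) fin finite_subset by blast
  have fB: "finite \<B>" using finX finA by (simp add: \<B>_def)
  have UB: "\<Union>\<B> = V" using XA(1,2) by (auto simp: \<B>_def)
  have neB: "B \<noteq> {}" if "B \<in> \<B>" for B using that cA by (force simp: \<B>_def)
  have dB: "pairwise disjnt \<B>"
  proof (rule pairwiseI)
    fix A B assume AB: "A \<in> \<B>" "B \<in> \<B>" "A \<noteq> B"
    show "disjnt A B"
    proof (cases "A \<in> \<A> \<and> B \<in> \<A>")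
      case True
      then show ?thesis using XA(3) AB(3) by (auto dest: pairwiseD)
    next
      case False
      then show ?thesis using AB AV by (auto simp: \<B>_def disjnt_def)
    qed
  qed
  have sB: "is_singleton B \<and> B \<inter> X = B \<or> B \<in> \<A>" if "B \<in> \<B>" for B using that by (auto simp: \<B>_def)
  have "alpha_le (block_adj M) \<B> a"
  proof (rule alpha_le_block_adj[OF sym irrM alphaM fB dB])
    show "\<Union>\<B> \<subseteq> V" using UB by simp
    show "is_singleton B \<or> a < card B" if "B \<in> \<B>" for B
      using sB[OF that] cA by (auto simp: Suc_le_eq)
    show "\<not> M x y" if "A \<in> \<B>" "B \<in> \<B>" "\<not> is_singleton A" "\<not> is_singleton B" "A \<noteq> B" "x \<in> A" "y \<in> B" for A B x y
    proof -
      have "A \<in> \<A>" "B \<in> \<A>" using sB that by blast+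
      from XA(5)[rule_format, OF this that(5-7)] show ?thesis .
    qed
  qed
  moreover have "symp (block_adj M)" by (auto simp: symp_def block_adj_def)
  moreover have "\<not> block_adj M B B" for B by (simp add: block_adj_def)
  ultimately obtain bs where bs: "distinct bs" "set bs = \<B>" "card (breaks (block_adj M) bs) \<le> a"
    using path_cover[of "block_adj M" \<B> a] fB by blast
  define n where "n = length bs"
  define B where "B i = bs ! i" for i
  define br where "br = breaks (block_adj M) bs"
  have BB: "B i \<in> \<B>" if "i < n" for i using that bs(2) by (auto simp: B_def n_def)
  have B_neq: "B i \<noteq> B j" if "i < n" "j < n" "i \<noteq> j" for i j
    using that bs(1) by (simp add: B_def n_def nth_eq_iff_index_eq)
  have B_disj: "B i \<inter> B j = {}" if "i < n" "j < n" "i \<noteq> j" for i j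
    using pairwiseD[OF dB BB[OF that(1)] BB[OF that(2)] B_neq[OF that]] by (simp add: disjnt_def)
  have UBn: "(\<Union>i<n. B i) = V"
    using UB bs(2) unfolding B_def n_def by (auto simp: in_set_conv_nth) (metis in_set_conv_nth UnionI)+
  have n0: "0 < n" using UBn \<open>V \<noteq> {}\<close> by (cases n) auto
  have nbr: "Suc i < n \<and> block_adj M (B i) (B (Suc i))" if "i < n" "i \<notin> br" for i
    using that by (auto simp: br_def breaks_def n_def B_def)
  \<comment> \<open>Entries are restricted only by a preceding singleton on the same path. After a
    large block, block \<open>i\<close> is itself a singleton and the choice is left to the exit set
    \<open>T (i - 1)\<close>.\<close>
  define S where "S i = {z \<in> B i. 0 < i \<and> i - 1 \<notin> br \<and> is_singleton (B (i - 1)) \<longrightarrow> M (the_elem (B (i - 1))) z}" for i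
  define T where "T i = {z \<in> B i. i \<notin> br \<and> is_singleton (B (Suc i)) \<longrightarrow> M (the_elem (B (Suc i))) z}" for i
  have att: "if is_singleton C then {z \<in> C. M y z} = C else 2 \<le> card {z \<in> C. M y z}" if "attached M y C" for y C
    using that by (auto simp: attached_def)
  have "\<exists>s\<in>S i. \<exists>t\<in>T i. s = t \<longleftrightarrow> is_singleton (B i)" if i: "i < n" for i
  proof (rule choose_ports)
    show "B i \<noteq> {}" using neB BB i by blast
    have big: "2 \<le> card (B i)" if "\<not> is_singleton (B i)"
      using sB[OF BB[OF i]] cA a that by fastforce
    have S: "if is_singleton (B i) then S i = B i else 2 \<le> card (S i)"
    proof (cases "0 < i \<and> i - 1 \<notin> br \<and> is_singleton (B (i - 1))")
      case True
      then obtain y where y: "B (i - 1) = {y}" by (auto simp: is_singleton_def)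
      have "block_adj M (B (i - 1)) (B i)" using nbr[of "i - 1"] i True by simp
      then have "block_adj M (B i) {y}" using y \<open>symp (block_adj M)\<close> by (metis sympD)
      from att[OF block_adj_singleton[OF sym this]] show ?thesis
        using True y by (simp add: S_def)
    next
      case False
      then have "S i = B i" by (auto simp: S_def)
      then show ?thesis using big by simp
    qed
    have T: "if is_singleton (B i) then T i = B i else 2 \<le> card (T i)"
    proof (cases "i \<notin> br \<and> is_singleton (B (Suc i))")
      case True
      then obtain y where y: "B (Suc i) = {y}" by (auto simp: is_singleton_def)
      then have "block_adj M (B i) {y}" using nbr[of i] i True by simp
      from att[OF block_adj_singleton[OF sym this]] show ?thesis
        using True y by (simp add: T_def)
    next
      case False
      then have "T i = B i" by (auto simp: T_def)
      then show ?thesis using big by simp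
    qed
    show "if is_singleton (B i) then S i = B i \<and> T i = B i else 2 \<le> card (S i) \<and> 2 \<le> card (T i)"
      using S T by presburger
  qed
  then obtain s t where st: "\<And>i. i < n \<Longrightarrow> s i \<in> S i" "\<And>i. i < n \<Longrightarrow> t i \<in> T i"
    "\<And>i. i < n \<Longrightarrow> s i = t i \<longleftrightarrow> is_singleton (B i)" by metis
  have stB: "s i \<in> B i" "t i \<in> B i" if "i < n" for i using st(1,2)[OF that] by (auto simp: S_def T_def)
  have M_nbr: "M (t i) (s (Suc i))" if i: "i < n" "i \<notin> br" for i
  proof -
    have i': "Suc i < n" "block_adj M (B i) (B (Suc i))" using nbr[OF i] by auto
    then consider "is_singleton (B i)" | "is_singleton (B (Suc i))"
      unfolding block_adj_def is_singleton_def by blast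
    then show ?thesis
    proof cases
      case 1
      then have "the_elem (B i) = t i" using stB(2)[OF i(1)] by (auto simp: is_singleton_def)
      then show ?thesis using st(1)[OF i'(1)] 1 i by (simp add: S_def)
    next
      case 2
      then have "the_elem (B (Suc i)) = s (Suc i)" using stB(1)[OF i'(1)] by (auto simp: is_singleton_def)
      then show ?thesis using st(2)[OF i(1)] 2 i sympD[OF sym] by (simp add: T_def)
    qed
  qed
  define nxt where "nxt i = (if Suc i = n then 0 else Suc i)" for i
  have nxt: "nxt i < n" if "i < n" for i using that n0 by (auto simp: nxt_def)
  define F where "F = X \<union> s ` {..<n} \<union> t ` {..<n}"
  have FV: "F \<subseteq> V" using XA(1) stB UBn by (auto simp: F_def)
  have F_mem: "t i \<in> F \<and> s (nxt i) \<in> F \<and> t i \<noteq> s (nxt i)" if i: "i < n" for i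
  proof -
    \<comment> \<open>With one block only, the link leads back into that block; having more than one
      vertex, it has distinct ports.\<close>
    have "t i \<noteq> s (nxt i)"
    proof (cases "nxt i = i")
      case True
      then have "n = 1" "i = 0" using i by (auto simp: nxt_def split: if_splits)
      then have "B 0 = V" using UBn by (simp add: lessThan_Suc)
      moreover have "card V \<noteq> 1" using card_V by simp
      ultimately have "\<not> is_singleton (B 0)" by (auto simp: is_singleton_altdef)
      then show ?thesis using st(3)[OF i] True \<open>i = 0\<close> by metis
    next
      case False
      then show ?thesis using stB(2)[OF i] stB(1)[OF nxt[OF i]] B_disj[OF i nxt[OF i]] by fastforce
    qed
    then show ?thesis using i nxt[OF i] by (auto simp: F_def)
  qed
  have cF: "card F \<le> card X + 2 * card \<A>"
  proof -
    define I where "I = {i. i < n \<and> B i \<in> \<A>}"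
    have finI: "finite I" by (simp add: I_def)
    have "inj_on B I" using B_neq by (auto simp: inj_on_def I_def)
    then have "card I = card (B ` I)" by (simp add: card_image)
    also have "\<dots> \<le> card \<A>" using finA by (intro card_mono) (auto simp: I_def)
    finally have cI: "card I \<le> card \<A>" .
    \<comment> \<open>Ports of singletons lie in \<open>X\<close>, so only the large blocks add to
      \<open>F\<close>, two ports each. This is why the decomposition counts
      \<open>2 * card \<A>\<close>.\<close>
    have "s i \<in> X \<and> t i \<in> X" if "i < n" "i \<notin> I" for i
      using sB[OF BB[OF that(1)]] that stB[OF that(1)] by (auto simp: I_def)
    then have "F \<subseteq> X \<union> (s ` I \<union> t ` I)" by (auto simp: F_def)
    then have "card F \<le> card (X \<union> (s ` I \<union> t ` I))" using finX finI by (intro card_mono) auto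
    also have "\<dots> \<le> card X + (card (s ` I) + card (t ` I))"
      by (meson add_left_mono card_Un_le le_trans)
    also have "\<dots> \<le> card X + 2 * card \<A>"
      using cI card_image_le[OF finI, of s] card_image_le[OF finI, of t] by linarith
    finally show ?thesis .
  qed
  define J where "J = {i. i < n \<and> \<not> E (t i) (s (nxt i))}"
  \<comment> \<open>Where there is no break, \<open>M_nbr\<close> gives a 2-cycle. The last position
    is always a break, so the pair that closes the cycle is covered too.\<close>
  have "J \<subseteq> br"
  proof
    fix i assume i: "i \<in> J"
    show "i \<in> br"
    proof (rule ccontr)
      assume "i \<notin> br"
      then show False using i M_nbr[of i] nbr[of i] ME by (auto simp: J_def nxt_def)
    qed
  qed
  moreover have "finite br" by (simp add: br_def breaks_def)
  ultimately have "card J \<le> a" using bs(3) card_mono le_trans unfolding br_def by blast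
  then have cJ: "card J * (2 * a - 2) \<le> l" unfolding l_def by (rule mult_le_mono1)
  have "\<exists>ys. (\<forall>i<n. successively E (t i # ys i @ [s (nxt i)]) \<and> distinct (ys i) \<and> set (ys i) \<subseteq> V - F) \<and>
     (\<forall>i<n. \<forall>j<n. i \<noteq> j \<longrightarrow> set (ys i) \<inter> set (ys j) = {}) \<and>
     card (\<Union>i<n. set (ys i)) \<le> card J * (2 * a - 2)"
    unfolding J_def
  proof (rule disjoint_short_links[OF irr conn alpha fin FV])
    show "card F + card {i. i < n \<and> \<not> E (t i) (s (nxt i))} * (2 * a - 2) < 2 * a ^ 3 + 2"
      using cF cJ budget unfolding J_def by linarith
  qed (use F_mem in auto)
  then obtain ys where
    ys: "\<forall>i<n. successively E (t i # ys i @ [s (nxt i)]) \<and> distinct (ys i) \<and> set (ys i) \<subseteq> V - F"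
    and ys_disj: "\<forall>i<n. \<forall>j<n. i \<noteq> j \<longrightarrow> set (ys i) \<inter> set (ys j) = {}"
    and ys_card: "card (\<Union>i<n. set (ys i)) \<le> card J * (2 * a - 2)"
    by (elim exE conjE)
  define L where "L = (\<Union>i<n. set (ys i))"
  have LV: "L \<subseteq> V" "L \<inter> F = {}" using ys by (auto simp: L_def)
  have cL: "card L \<le> l" using ys_card cJ by (simp add: L_def)
  have "\<exists>P. distinct P \<and> set P = B i - L \<and> successively M P \<and> P \<noteq> [] \<and> hd P = s i \<and> last P = t i"
    if i: "i < n" for i
  proof -
    \<comment> \<open>Links avoid \<open>F\<close>, so no port is deleted; in particular singleton
      blocks stay intact.\<close>
    have nL: "s i \<notin> L" "t i \<notin> L" using LV(2) i by (auto simp: F_def)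
    show ?thesis
    proof (cases "is_singleton (B i)")
      case True
      then have "B i = {s i}" "t i = s i" using stB[OF i] by (auto simp: is_singleton_def)
      then show ?thesis using nL by (intro exI[of _ "[s i]"]) auto
    next
      case False
      then have BA: "B i \<in> \<A>" using sB[OF BB[OF i]] by blast
      have finB: "finite (B i)" using AV(1)[OF BA] fin finite_subset by blast
      have LL: "L \<inter> B i \<subseteq> B i" "B i - L \<inter> B i = B i - L" by auto
      have "card (L \<inter> B i) \<le> l"
        using cL card_mono[of L "L \<inter> B i"] LV(1) fin finite_subset[of L V] by fastforce
      then have "robust M a (B i - L \<inter> B i)"
        using robust_Diff[OF finB _ LL(1)] XA(4) BA by blast
      then have "robust M a (B i - L)" by (simp only: LL(2))
      moreover have "alpha_le M (B i - L) a" using alpha_le_mono[OF alphaM, of "B i - L" a] AV(1)[OF BA] by blast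
      moreover have "s i \<noteq> t i" using st(3)[OF i] False by simp
      ultimately show ?thesis
        using robust_hamilton_connected[of "B i - L" M a "s i" "t i"] finB sym irrM stB[OF i] nL by simp
    qed
  qed
  then obtain P where P: "\<And>i. i < n \<Longrightarrow> distinct (P i) \<and> set (P i) = B i - L \<and>
      successively M (P i) \<and> P i \<noteq> [] \<and> hd (P i) = s i \<and> last (P i) = t i" by metis
  \<comment> \<open>The final vertex \<open>s (nxt i)\<close> of the link is left out, as the next
    piece begins with it.\<close>
  define c where "c i = P i @ ys i" for i
  define p where "p = concat (map c [0..<n])"
  have c1: "c i \<noteq> [] \<and> successively E (c i) \<and> hd (c i) = s i \<and> E (last (c i)) (s (nxt i))" if i: "i < n" for i
  proof -
    have "successively E (P i)" using P[OF i] ME by (auto elim: successively_mono)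
    moreover have "successively E (t i # ys i @ [s (nxt i)])" using ys i by blast
    ultimately show ?thesis using P[OF i] unfolding c_def
      by (cases "ys i = []") (auto simp: successively_append_iff successively_Cons hd_append)
  qed
  have distinct_p: "distinct p"
    unfolding p_def
  proof (rule distinct_concat_upt; intro allI impI)
    show "distinct (c i)" if "i < n" for i
      using P[OF that] ys that unfolding c_def L_def by auto
    show "set (c i) \<inter> set (c j) = {}" if ij: "i < n" "j < n" "i \<noteq> j" for i j
    proof -
      have "set (ys i) \<subseteq> L" "set (ys j) \<subseteq> L" using ij by (auto simp: L_def)
      then show ?thesis
        using P[OF ij(1)] P[OF ij(2)] B_disj[OF ij] ys_disj[rule_format, OF ij] unfolding c_def by auto
    qed
  qed
  have set_p: "set p = V"
  proof -
    have "set p = (\<Union>i<n. set (P i)) \<union> L" by (auto simp: p_def c_def L_def)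
    also have "(\<Union>i<n. set (P i)) = (\<Union>i<n. B i) - L" using P by auto
    finally show ?thesis using UBn LV(1) by auto
  qed
  have step: "E (last (c i)) (hd (c (Suc i)))" if "Suc i < n" for i
    using c1[of i] c1[OF that] that by (simp add: nxt_def)
  moreover have "successively E p \<and> p \<noteq> [] \<and> hd p = hd (c 0) \<and> last p = last (c (n - 1))"
    unfolding p_def using c1 n0 step by (intro successively_concat_upt) auto
  moreover have "E (last (c (n - 1))) (hd (c 0))"
    using c1[of "n - 1"] c1[of 0] n0 by (auto simp: nxt_def)
  ultimately show ?thesis by (intro exI[of _ p]) (simp add: distinct_p set_p)
qed

section \<open>Translation to digraphs\<close>

lemma (in digraph) hamiltonian_of_list:
  assumes p: "p \<noteq> []" "distinct p" "set p = verts G"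
    and walk: "successively (dominates G) p" "last p \<rightarrow>\<^bsub>G\<^esub> hd p"
  shows "hamiltonian G"
proof -
  \<comment> \<open>The tails of the arcs of a walk are all its vertices but the last, so the closed
    walk \<open>p @ [hd p]\<close> has tail list \<open>p\<close>.\<close>
  have ex: "\<exists>es. awalk u es v \<and> awalk_verts u es = xs @ [v] \<and> map (tail G) es = xs"
    if "successively (\<lambda>x y. x \<rightarrow>\<^bsub>G\<^esub> y) (xs @ [v])" "hd (xs @ [v]) = u" "v \<in> verts G" for xs u v
    using that
  proof (induction xs arbitrary: u)
    case Nil
    then show ?case by (intro exI[of _ "[]"]) (auto simp: awalk_def)
  next
    case (Cons x xs)
    define w where "w = hd (xs @ [v])"
    have "x \<rightarrow>\<^bsub>G\<^esub> w" using Cons.prems(1) by (auto simp: w_def successively_Cons)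
    then obtain e where e: "e \<in> arcs G" "tail G e = x" "head G e = w" by auto
    obtain es where es: "awalk w es v" "awalk_verts w es = xs @ [v]" "map (tail G) es = xs"
      using Cons.IH[of w] Cons.prems by (auto simp: w_def successively_Cons)
    have "u = x" using Cons.prems(2) by simp
    then show ?case using e es
      by (intro exI[of _ "e # es"]) (auto simp: awalk_Cons_iff)
  qed
  define u where "u = hd p"
  have "u \<in> verts G" using hd_in_set[OF p(1)] p(3) by (simp add: u_def)
  moreover have "successively (\<lambda>x y. x \<rightarrow>\<^bsub>G\<^esub> y) (p @ [u])"
    using walk p(1) by (simp add: successively_append_iff u_def)
  moreover have "hd (p @ [u]) = u" using p(1) by (simp add: u_def)
  ultimately obtain es where es: "awalk u es u" "awalk_verts u es = p @ [u]" "map (tail G) es = p"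
    using ex by blast
  have "es \<noteq> []" using es(3) p(1) by auto
  \<comment> \<open>Without its first vertex the closed walk is a rotation of
    \<open>p\<close>.\<close>
  moreover have "distinct (tl (awalk_verts u es))"
    unfolding es(2) using p(1,2) by (cases p) (auto simp: u_def)
  ultimately have "cycle es" using es(1) unfolding cycle_def by blast
  moreover have "tail G ` set es = verts G" using es(3) p(3) by (metis set_map)
  ultimately show ?thesis unfolding hamiltonian_def hamilton_cycle_def by blast
qed

text \<open>Stated for arbitrary vertex and arc types: the bound on \<open>f2\<close> uses it over
  \<open>nat\<close>, the second claim of the theorem over any types.\<close>

lemma hamiltonian_if_k_connected:
  assumes "digraph D" "k_connected (2 * a ^ 3 + 2) D" "alpha2 D \<le> a"
  shows "hamiltonian D"
proof -
  interpret digraph D by fact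
  define E where "E x y \<longleftrightarrow> x \<rightarrow>\<^bsub>D\<^esub> y" for x y
  have "\<exists>p. p \<noteq> [] \<and> distinct p \<and> set p = verts D \<and> successively E p \<and> E (last p) (hd p)"
  proof (rule hamilton_cycle_list)
    show "finite (verts D)" by simp
    show "\<not> E x x" for x using adj_not_same unfolding E_def by blast
    show "2 * a ^ 3 + 2 < card (verts D)" using assms(2) by (simp add: k_connected_def)
    show "k_connected_rel E (verts D) (2 * a ^ 3 + 2)"
      unfolding k_connected_rel_def
    proof (intro allI impI ballI)
      fix X u v assume X: "X \<subseteq> verts D" "card X < 2 * a ^ 3 + 2" and uv: "u \<in> verts D - X" "v \<in> verts D - X"
      define H where "H = D \<restriction> (verts D - X)"
      have "strongly_connected H" using assms(2) X unfolding k_connected_def H_def by blast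
      then have "u \<rightarrow>\<^sup>*\<^bsub>H\<^esub> v" using uv unfolding H_def by auto
      then have "(u, v) \<in> rtrancl_on (verts H) (arcs_ends H)" by (simp add: reachable_def)
      then show "(\<lambda>x y. E x y \<and> x \<in> verts D - X \<and> y \<in> verts D - X)\<^sup>*\<^sup>* u v"
      proof induction
        case (step y z)
        have "E y z \<and> y \<in> verts D - X \<and> z \<in> verts D - X"
          using step.hyps unfolding E_def H_def by (auto simp: arcs_ends_conv)
        then show ?case using step.IH by (rule converse_rtranclp_into_rtranclp)
      qed simp
    qed
    show "alpha_le (mutual E) (verts D) a"
      unfolding alpha_le_def
    proof (intro allI impI)
      fix S assume S: "S \<subseteq> verts D" "indep (mutual E) S"
      define G where "G = with_proj (two_cycle_graph D)"
      have "independent_set G S"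
        using S unfolding independent_set_def G_def indep_def mutual_def E_def
        by (auto simp: two_cycle_graph_def arcs_ends_def arc_to_ends_def)
      moreover have "finite {S. independent_set G S}"
        by (rule finite_subset[of _ "Pow (verts D)"]) (auto simp: independent_set_def G_def two_cycle_graph_def)
      ultimately have "card S \<le> independence_number G"
        unfolding independence_number_def by (intro Max_ge) auto
      then show "card S \<le> a" using assms(3) by (simp add: alpha2_def G_def)
    qed
  qed
  then show ?thesis using hamiltonian_of_list unfolding E_def by blast
qed

theorem theorem1p1:
  fixes a :: nat
  assumes "a \<ge> 1"
  shows "f2 a \<le> 2 * a ^ 3 + 2 \<and>
    (\<forall>D :: ('a, 'b) pre_digraph.
       digraph D \<and> k_connected (2 * a ^ 3 + 2) D \<and> alpha2 D \<le> a \<longrightarrow> hamiltonian D)"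
proof
  show "f2 a \<le> 2 * a ^ 3 + 2"
    unfolding f2_def by (rule Least_le) (auto intro: hamiltonian_if_k_connected)
qed (auto intro: hamiltonian_if_k_connected)

end
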